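(* For every integer $n\ge 1$, let $r\in(0,1)$ be the unique solution in $(0,1)$ of $r^n\bigl(1+n(1+r)\bigr)=1$, and put $h=1+r$ and $\eta=r^n$. Then the constant schedule $(h,\ldots,h)$ of length $n$ is $s$-composable with rate $\eta$.
   Context: A function $f:\mathbb{R}^d\to\mathbb{R}$ is $1$-smooth if it is differentiable and its gradient is $1$-Lipschitz for the Euclidean norm $\|\cdot\|$. Definition ($s$-composability). Let $\mathbf h=(h_0,\ldots,h_{m-1})$ be a vector of positive reals. The schedule $\mathbf h$ is $s$-composable with rate $\eta$ if both of the following hold. (1) For every dimension $d$, every $1$-smooth convex $f:\mathbb{R}^d\to\mathbb{R}$, every minimizer $x_\star$ of $f$, and every initial point $x_0\in\mathbb{R}^d$, the gradient-descent trajectory $x_{i+1}=x_i-h_i\nabla f(x_i)$, $i=0,\ldots,m-1$, satisfies $$\frac{1-\eta}{2}\|\nabla f(x_m)\|^2+\frac{\eta^2}{2}\|x_m-x_\star\|^2+(\eta-\eta^2)\bigl(f(x_m)-f(x_\star)\bigr)\le\frac{\eta^2}{2}\|x_0-x_\star\|^2 .$$ (2) $\displaystyle \eta=\frac{1}{1+\sum_{i=0}^{m-1}h_i}=\prod_{i=0}^{m-1}(h_i-1)$. *)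

theory Defs
  imports "HOL-Analysis.Analysis"
begin

(* Meaningful only where f is differentiable; GDERIV determines the gradient uniquely. *)
definition grad :: "('a::real_inner \<Rightarrow> real) \<Rightarrow> 'a \<Rightarrow> 'a" where
  "grad f x = (THE g. GDERIV f x :> g)"

definition one_smooth :: "('a::real_inner \<Rightarrow> real) \<Rightarrow> bool" where
  "one_smooth f \<longleftrightarrow> f differentiable_on UNIV \<and> 1-lipschitz_on UNIV (grad f)"

(* hs ! i is used only for i < length hs. *)
primrec gd_iterate :: "('a::real_inner \<Rightarrow> real) \<Rightarrow> real list \<Rightarrow> 'a \<Rightarrow> nat \<Rightarrow> 'a" where
  "gd_iterate f hs x0 0 = x0"
| "gd_iterate f hs x0 (Suc i) =
     gd_iterate f hs x0 i - (hs ! i) *\<^sub>R grad f (gd_iterate f hs x0 i)"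

(* Condition (1) of s-composability in the fixed dimension d = CARD('n). *)
definition s_composable_bound :: "'n::finite itself \<Rightarrow> real list \<Rightarrow> real \<Rightarrow> bool" where
  "s_composable_bound TYPE('n) hs \<eta> \<longleftrightarrow>
    (\<forall>(f :: real ^ 'n \<Rightarrow> real) xstar x0.
       one_smooth f \<longrightarrow> convex_on UNIV f \<longrightarrow> (\<forall>y. f xstar \<le> f y) \<longrightarrow>
       (let xm = gd_iterate f hs x0 (length hs) in
         (1 - \<eta>) / 2 * (norm (grad f xm))\<^sup>2 + \<eta>\<^sup>2 / 2 * (norm (xm - xstar))\<^sup>2
           + (\<eta> - \<eta>\<^sup>2) * (f xm - f xstar)
         \<le> \<eta>\<^sup>2 / 2 * (norm (x0 - xstar))\<^sup>2))"

(* A HOL formula cannot quantify over the dimension CARD('n). Being s-composable, i.e. satisfying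
   the bound in every dimension, is expressed by asserting s_composable TYPE('n) with 'n
   a free type variable, which a theorem quantifies universally. Condition (2) does not
   involve 'n. *)
definition s_composable :: "'n::finite itself \<Rightarrow> real list \<Rightarrow> real \<Rightarrow> bool" where
  "s_composable TYPE('n) hs \<eta> \<longleftrightarrow>
     (\<forall>h\<in>set hs. h > 0) \<and>
     s_composable_bound TYPE('n) hs \<eta> \<and>
     \<eta> = 1 / (1 + (\<Sum>i<length hs. hs ! i)) \<and>
     \<eta> = (\<Prod>i<length hs. hs ! i - 1)"

end

theory Submission
  imports Defs
begin

text \<open>Write \<open>g\<^sub>i\<close> for the gradient at \<open>x\<^sub>i\<close>. Summing the interpolation inequalities between the iterates and
  the minimizer along the expansion of \<open>\<parallel>x\<^sub>i\<^sub>+\<^sub>1 - x\<^sub>\<star>\<parallel>\<^sup>2\<close> reduces the bound to a statement about the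
  iterates alone: \<open>2 \<Sum>\<^sub>j\<^sub><\<^sub>n (f(x\<^sub>j) - f(x\<^sub>n)) \<ge> r \<Sum>\<^sub>j\<^sub><\<^sub>n \<parallel>g\<^sub>j\<parallel>\<^sup>2 + n r\<^sup>-\<^sup>n \<parallel>g\<^sub>n\<parallel>\<^sup>2\<close>. In Moreau coordinates
  \<open>y\<^sub>i = x\<^sub>i - g\<^sub>i\<close>, \<open>\<phi>\<^sub>i = f(x\<^sub>i) - \<parallel>g\<^sub>i\<parallel>\<^sup>2 / 2\<close> the interpolation inequalities become the plain subgradient
  inequalities \<open>\<phi>\<^sub>i - \<phi>\<^sub>j \<ge> \<langle>g\<^sub>j, y\<^sub>i - y\<^sub>j\<rangle>\<close>, and the step becomes \<open>y\<^sub>k - y\<^sub>k\<^sub>+\<^sub>1 = g\<^sub>k\<^sub>+\<^sub>1 + r g\<^sub>k\<close>. The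
  statement is then exactly a nonnegative combination of them, with no sum of squares left over;
  only the pairs \<open>(i,j)\<close> with \<open>i < j\<close>, \<open>(i+1,i)\<close> and \<open>(n,i)\<close> carry weight.\<close>

section \<open>Weighted averages of powers and the multipliers\<close>

text \<open>For \<open>m \<ge> 1\<close> this is the average of \<open>\<rho>\<^sup>k\<close> over \<open>1 \<le> k \<le> m\<close> with weights proportional to \<open>m + 1 - k\<close>;
  the value at \<open>0\<close> is chosen to keep the sequence monotone.\<close>
primrec wavg :: "real \<Rightarrow> nat \<Rightarrow> real" where
  "wavg \<rho> 0 = 1"
| "wavg \<rho> (Suc m) = \<rho> * (real m * wavg \<rho> m + 2) / (real m + 2)"

lemma wavg_Suc_mult: "(real m + 2) * wavg \<rho> (Suc m) = \<rho> * (real m * wavg \<rho> m + 2)"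
  by simp

lemma wavg_ge_1:
  assumes "\<rho> \<ge> 1"
  shows "wavg \<rho> m \<ge> 1"
proof (induction m)
  case (Suc m)
  have "real m * 1 \<le> real m * wavg \<rho> m"
    using Suc by (intro mult_left_mono) auto
  hence "1 * (real m + 2) \<le> \<rho> * (real m * wavg \<rho> m + 2)"
    using assms by (intro mult_mono) auto
  thus ?case by (simp add: pos_le_divide_eq)
qed simp

lemma wavg_Suc_ge:
  assumes "\<rho> \<ge> 1"
  shows "wavg \<rho> (Suc m) \<ge> \<rho>"
proof -
  have "real m * 1 \<le> real m * wavg \<rho> m"
    using wavg_ge_1[OF assms] by (intro mult_left_mono) auto
  hence "\<rho> * (real m + 2) \<le> \<rho> * (real m * wavg \<rho> m + 2)"
    using assms by (intro mult_left_mono) auto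
  thus ?thesis by (simp add: pos_le_divide_eq)
qed

text \<open>Subtracting consecutive recurrences expresses the next increment as a nonnegative
  multiple of the current one plus a nonnegative term, so the sign propagates from
  \<open>wavg \<rho> 0 = 1\<close> and \<open>wavg \<rho> 1 = \<rho>\<close>.\<close>

lemma wavg_mono:
  assumes "\<rho> \<ge> 1"
  shows "mono (wavg \<rho>)"
proof (rule incseq_SucI)
  fix m
  show "wavg \<rho> m \<le> wavg \<rho> (Suc m)"
  proof (induction m)
    case (Suc m)
    let ?E = "wavg \<rho>"
    have "(real m + 3) * ?E (Suc (Suc m)) = \<rho> * ((real m + 1) * ?E (Suc m) + 2)"
      using wavg_Suc_mult[of "Suc m" \<rho>] by (simp del: wavg.simps add: algebra_simps)
    moreover note wavg_Suc_mult[of m \<rho>]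
    ultimately have "(real m + 3) * (?E (Suc (Suc m)) - ?E (Suc m))
        = \<rho> * real m * (?E (Suc m) - ?E m) + (\<rho> - 1) * ?E (Suc m)"
      by (simp del: wavg.simps add: algebra_simps)
    also have "\<dots> \<ge> 0"
      using Suc assms wavg_ge_1[OF assms, of "Suc m"]
      by (intro add_nonneg_nonneg mult_nonneg_nonneg) auto
    finally show ?case
      by (simp del: wavg.simps add: zero_le_mult_iff)
  qed (use assms in simp)
qed

text \<open>Summation of the weighted geometric series. Denominators are cleared, so that
  \<open>m = 0\<close> and \<open>r\<^sup>2 = 1\<close> need no separate treatment.\<close>

lemma wavg_closed_form:
  assumes "r \<noteq> 0"
  shows "real m * (real m + 1) * (1 - r\<^sup>2)\<^sup>2 * wavg (1 / r\<^sup>2) m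
    = 2 * ((1 / r\<^sup>2) ^ m - 1 - real m * (1 - r\<^sup>2))"
proof (induction m)
  case (Suc m)
  let ?\<rho> = "1 / r\<^sup>2"
  have r: "?\<rho> * r\<^sup>2 = 1" using assms by simp
  have "real (Suc m) * (real (Suc m) + 1) * (1 - r\<^sup>2)\<^sup>2 * wavg ?\<rho> (Suc m)
      = (real m + 1) * (1 - r\<^sup>2)\<^sup>2 * ((real m + 2) * wavg ?\<rho> (Suc m))"
    by (simp del: wavg.simps add: algebra_simps)
  also have "\<dots> = ?\<rho> * (real m * (real m + 1) * (1 - r\<^sup>2)\<^sup>2 * wavg ?\<rho> m)
      + 2 * ?\<rho> * (real m + 1) * (1 - r\<^sup>2)\<^sup>2"
    unfolding wavg_Suc_mult by (simp only: ring_distribs mult_ac)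
  also have "\<dots> = ?\<rho> * (2 * (?\<rho> ^ m - 1 - real m * (1 - r\<^sup>2)))
      + 2 * ?\<rho> * (real m + 1) * (1 - r\<^sup>2)\<^sup>2"
    by (simp only: Suc)
  also have "\<dots> = 2 * (?\<rho> ^ Suc m - 1 - real (Suc m) * (1 - r\<^sup>2))"
    using r unfolding power_Suc of_nat_Suc by algebra
  finally show ?case .
qed simp

text \<open>\<open>\<alpha> t\<close> is the sum of the first \<open>t\<close> weights \<open>a\<^sub>i\<close>, where \<open>a\<^sub>i\<close> is carried by every pair \<open>(i,j)\<close> with
  \<open>i + 2 \<le> j < n\<close>. The recurrence is what remains of the coefficient equations once all other
  weights are expressed through \<open>\<alpha>\<close>; the root equation is equivalent to \<open>\<alpha> 0 = 0\<close>.\<close>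
lemma multipliers_exist:
  fixes r :: real
  assumes r: "0 < r" "r < 1" and n: "n \<ge> 1" and root: "r ^ n * (1 + real n * (1 + r)) = 1"
  obtains \<alpha> :: "nat \<Rightarrow> real" where
    "\<alpha> 0 = 0"
    "\<And>t. Suc t < n \<Longrightarrow> (real n - 1 - real t) * \<alpha> (Suc t)
        = (real n + 1 - real t) * \<alpha> t + 1 - (1 - r)\<^sup>2 / 2 * (1 / r\<^sup>2) ^ Suc t"
    "\<And>t. Suc t < n \<Longrightarrow> \<alpha> t \<le> \<alpha> (Suc t)"
    "\<And>t. t < n \<Longrightarrow> \<alpha> t \<le> ((1 / r\<^sup>2) ^ t - 1) / 2"
    "2 * \<alpha> (n - 1) = (1 - r)\<^sup>2 / 2 * (1 / r\<^sup>2) ^ n - 1"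
proof
  define \<rho> where "\<rho> = 1 / r\<^sup>2"
  \<comment> \<open>The constant \<open>- 1 / 2\<close> absorbs the summand \<open>1\<close> of the
    recurrence; dividing what is left by \<open>\<rho> ^ t\<close> gives the recurrence of
    \<open>wavg\<close>, run backwards from \<open>n\<close>.\<close>
  define \<alpha> where "\<alpha> t = (1 - r)\<^sup>2 / 4 * \<rho> ^ t * wavg \<rho> (n - t) - 1 / 2" for t
  have \<rho>: "\<rho> \<ge> 1"
    using r by (simp add: \<rho>_def power_le_one)
  have "\<rho> ^ n * (r ^ n)\<^sup>2 = 1"
    using r by (simp add: \<rho>_def power_divide flip: power_mult) (simp add: mult.commute)
  hence "\<rho> ^ n * (r ^ n * (1 + real n * (1 + r)))\<^sup>2 = (1 + real n * (1 + r))\<^sup>2"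
    unfolding power_mult_distrib mult.assoc[symmetric] by simp
  hence \<rho>n: "\<rho> ^ n = (1 + real n * (1 + r))\<^sup>2"
    unfolding root by simp
  \<comment> \<open>By the squared root equation,
    \<open>\<rho> ^ n - 1 - n * (1 - r\<^sup>2)\<close> factors as
    \<open>n * (n + 1) * (1 + r)\<^sup>2\<close>, which then cancels.\<close>
  have "(real n * (real n + 1) * (1 + r)\<^sup>2) * ((1 - r)\<^sup>2 * wavg \<rho> n)
      = real n * (real n + 1) * (1 - r\<^sup>2)\<^sup>2 * wavg \<rho> n"
    by algebra
  also have "\<dots> = 2 * (\<rho> ^ n - 1 - real n * (1 - r\<^sup>2))"
    using wavg_closed_form[of r n] r by (simp add: \<rho>_def)
  also have "\<dots> = (real n * (real n + 1) * (1 + r)\<^sup>2) * 2"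
    unfolding \<rho>n by algebra
  finally have En: "(1 - r)\<^sup>2 * wavg \<rho> n = 2"
    using r n by simp
  show "\<alpha> 0 = 0"
    using En by (simp add: \<alpha>_def)
  have rec: "(real n - 1 - real t) * \<alpha> (Suc t)
      = (real n + 1 - real t) * \<alpha> t + 1 - (1 - r)\<^sup>2 / 2 * \<rho> ^ Suc t" if t: "Suc t < n" for t
  proof -
    obtain m where m: "n = t + Suc (Suc m)"
      using t less_iff_Suc_add[of "Suc t" n] by auto
    have "(real m + 3) * wavg \<rho> (Suc (Suc m)) = \<rho> * ((real m + 1) * wavg \<rho> (Suc m) + 2)"
      using wavg_Suc_mult[of "Suc m" \<rho>] by (simp del: wavg.simps add: algebra_simps)
    moreover have "real n - 1 - real t = real m + 1" "real n + 1 - real t = real m + 3"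
      "n - t = Suc (Suc m)" "n - Suc t = Suc m"
      using m by auto
    moreover define E E' P q where "E = wavg \<rho> (Suc m)" and "E' = wavg \<rho> (Suc (Suc m))"
      and "P = \<rho> ^ t" and "q = (1 - r)\<^sup>2 / 4"
    moreover have "(1 - r)\<^sup>2 / 2 = 2 * q" by (simp add: q_def)
    ultimately show ?thesis
      unfolding \<alpha>_def power_Suc by (simp del: wavg.simps add: algebra_simps)
  qed
  thus "(real n - 1 - real t) * \<alpha> (Suc t)
      = (real n + 1 - real t) * \<alpha> t + 1 - (1 - r)\<^sup>2 / 2 * (1 / r\<^sup>2) ^ Suc t"
    if "Suc t < n" for t
    using that by (simp add: \<rho>_def)
  show "\<alpha> t \<le> \<alpha> (Suc t)" if t: "Suc t < n" for t
  proof -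
    have "(real n - 1 - real t) * (\<alpha> (Suc t) - \<alpha> t)
        = 2 * \<alpha> t + 1 - (1 - r)\<^sup>2 / 2 * \<rho> ^ Suc t"
      using rec[OF t] by (simp add: algebra_simps)
    also have "\<dots> = (1 - r)\<^sup>2 / 2 * \<rho> ^ t * (wavg \<rho> (n - t) - \<rho>)"
      by (simp add: \<alpha>_def algebra_simps)
    also have "\<dots> \<ge> 0"
      using wavg_Suc_ge[OF \<rho>, of "n - Suc t"] \<rho> t by (simp del: wavg.simps add: Suc_diff_Suc)
    finally show ?thesis
      using t by (simp add: zero_le_mult_iff)
  qed
  show "\<alpha> t \<le> ((1 / r\<^sup>2) ^ t - 1) / 2" if "t < n" for t
  proof -
    have "(1 - r)\<^sup>2 * wavg \<rho> (n - t) \<le> (1 - r)\<^sup>2 * wavg \<rho> n"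
      using monoD[OF wavg_mono[OF \<rho>]] by (intro mult_left_mono) auto
    hence "\<rho> ^ t * ((1 - r)\<^sup>2 * wavg \<rho> (n - t)) \<le> \<rho> ^ t * 2"
      unfolding En using \<rho> by (intro mult_left_mono) auto
    thus ?thesis
      unfolding \<alpha>_def \<rho>_def[symmetric] by (simp add: algebra_simps)
  qed
  show "2 * \<alpha> (n - 1) = (1 - r)\<^sup>2 / 2 * (1 / r\<^sup>2) ^ n - 1"
    using n unfolding \<alpha>_def \<rho>_def[symmetric] by (cases n) auto
qed

section \<open>The weighted sum of subgradient inequalities\<close>

text \<open>The function itself is gone: the claim is linear in the \<open>\<phi>\<close> values and
  the inner products of the \<open>g\<close> vectors, so the proof is a matching of coefficients.
  Only differences of \<open>\<phi>\<close> enter the hypotheses, which permits the normalisation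
  \<open>\<phi> n = 0\<close>.\<close>

lemma weighted_gap:
  fixes g y :: "nat \<Rightarrow> 'a::real_inner" and \<phi> :: "nat \<Rightarrow> real"
  assumes r: "0 < r" "r < 1" and n: "n \<ge> 1" and root: "r ^ n * (1 + real n * (1 + r)) = 1"
    and subgrad: "\<And>i j. i \<le> n \<Longrightarrow> j \<le> n \<Longrightarrow> inner (g j) (y i - y j) \<le> \<phi> i - \<phi> j"
    and step: "\<And>k. k < n \<Longrightarrow> y k - y (Suc k) = g (Suc k) + r *\<^sub>R g k"
    and \<phi>n: "\<phi> n = 0"
  shows "real n * (1 + 1 / r ^ n) / 2 * inner (g n) (g n)
    \<le> (\<Sum>j<n. \<phi> j + (1 - r) / 2 * inner (g j) (g j))"
proof -
  define \<rho> where "\<rho> = 1 / r\<^sup>2"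
  obtain \<alpha> :: "nat \<Rightarrow> real" where \<alpha>0: "\<alpha> 0 = 0"
    and \<alpha>_rec: "\<And>t. Suc t < n \<Longrightarrow> (real n - 1 - real t) * \<alpha> (Suc t)
        = (real n + 1 - real t) * \<alpha> t + 1 - (1 - r)\<^sup>2 / 2 * \<rho> ^ Suc t"
    and \<alpha>_mono: "\<And>t. Suc t < n \<Longrightarrow> \<alpha> t \<le> \<alpha> (Suc t)"
    and \<alpha>_le: "\<And>t. t < n \<Longrightarrow> \<alpha> t \<le> (\<rho> ^ t - 1) / 2"
    and \<alpha>_last: "2 * \<alpha> (n - 1) = (1 - r)\<^sup>2 / 2 * \<rho> ^ n - 1"
    using multipliers_exist[OF r n root] unfolding \<rho>_def by blast
  have \<alpha>_nonneg: "\<alpha> t \<ge> 0" if "t < n" for t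
    using that by (induction t) (use \<alpha>0 \<alpha>_mono in \<open>auto intro: order_trans\<close>)
  \<comment> \<open>Weights: \<open>a i\<close> on \<open>(i,j)\<close> for \<open>i + 2 \<le> j < n\<close> and \<open>a i / (1 + r)\<close> on \<open>(i,n)\<close>; \<open>D j - \<alpha> (j - 1)\<close> on
    \<open>(j - 1,j)\<close>; \<open>\<beta> j\<close> on \<open>(j + 1,j)\<close>; \<open>\<gamma> j\<close> on \<open>(n,j)\<close>. The pair \<open>{n - 1,n}\<close> gets \<open>L - q\<close> and \<open>r * L + q\<close>.\<close>
  define a where "a t = \<alpha> (Suc t) - \<alpha> t" for t
  define \<gamma> where "\<gamma> t = (r * \<alpha> (Suc t) + \<alpha> t) / (1 + r)" for t
  define D where "D t = ((\<rho> ^ t - 1) / 2 + r * \<alpha> t) / (1 + r)" for t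
  define \<beta> where "\<beta> t = r * (D (Suc t) - \<alpha> (Suc t))" for t
  define p where "p k = g (Suc k) + r *\<^sub>R g k" for k
  \<comment> \<open>\<open>V k\<close> is the weighted slack of the pairs \<open>(n,s)\<close> with
    \<open>s < k\<close>, but with \<open>y n\<close> replaced by \<open>y k\<close>;
    \<open>Z k\<close> gathers the displacements of the pairs \<open>(i,k)\<close>. Moving the base
    point to \<open>y (Suc k)\<close> adds \<open>p k\<close> to every displacement.\<close>
  define R where "R k = (\<Sum>s<k. \<gamma> s *\<^sub>R g s)" for k
  define \<Phi> where "\<Phi> k = (\<Sum>i<k. a i * \<phi> i)" for k
  define V where "V k = (\<Sum>s<k. \<gamma> s * (inner (g s) (y s - y k) - \<phi> s))" for k
  define Z where "Z k = (\<Sum>i<k. a i *\<^sub>R (y i - y k))" for k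
  define H where "H k = (\<Sum>j<k. \<phi> j + (1 - r) / 2 * inner (g j) (g j))" for k
  have r1: "1 + r > 0" using r by simp
  have a_nonneg: "a t \<ge> 0" if "Suc t < n" for t
    using \<alpha>_mono[OF that] by (simp add: a_def)
  have \<gamma>_nonneg: "\<gamma> t \<ge> 0" if "Suc t < n" for t
    using \<alpha>_nonneg[of t] \<alpha>_nonneg[of "Suc t"] that r by (simp add: \<gamma>_def)
  have D_mult: "2 * (1 + r) * D t = \<rho> ^ t - 1 + 2 * r * \<alpha> t" for t
  proof -
    have "(1 + r) * D t = (\<rho> ^ t - 1) / 2 + r * \<alpha> t"
      using r1 by (simp add: D_def)
    thus ?thesis by (simp only: mult.assoc) simp
  qed
  have D_ge: "D t \<ge> \<alpha> t" if "t < n" for t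
  proof -
    have "D t - \<alpha> t = ((\<rho> ^ t - 1) / 2 - \<alpha> t) / (1 + r)"
      using r1 by (simp add: D_def divide_simps) (simp add: algebra_simps)
    also have "\<dots> \<ge> 0" using \<alpha>_le[OF that] r1 by simp
    finally show ?thesis by simp
  qed
  have sum_a: "(\<Sum>i<k. a i) = \<alpha> k" for k
    by (induction k) (auto simp: \<alpha>0 a_def)
  have Y: "y k - y (Suc k) = p k" if "k < n" for k
    using step[OF that] by (simp add: p_def)
  have Z_shift: "(\<Sum>i<k. a i *\<^sub>R (y i - y (Suc k))) = Z k + \<alpha> k *\<^sub>R p k" if "k < n" for k
  proof -
    have "y i - y (Suc k) = (y i - y k) + p k" for i
      using Y[OF that] by (simp add: algebra_simps)
    hence "(\<Sum>i<k. a i *\<^sub>R (y i - y (Suc k))) = (\<Sum>i<k. a i *\<^sub>R (y i - y k) + a i *\<^sub>R p k)"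
      by (simp only: scaleR_add_right)
    thus ?thesis
      by (simp only: Z_def sum.distrib scaleR_left.sum[symmetric] sum_a)
  qed
  \<comment> \<open>This identity dictates \<open>\<gamma>\<close>: it makes the products of earlier
    gradients with the newest one, coming from the pairs \<open>(i,k)\<close>, cancel those coming
    from \<open>V\<close> and \<open>R\<close>.\<close>
  have Z_eq: "Z k = (1 + r) *\<^sub>R R k + \<alpha> k *\<^sub>R g k" if "k \<le> n" for k
    using that
  proof (induction k)
    case (Suc k)
    have \<gamma>: "(1 + r) * \<gamma> k = r * \<alpha> (Suc k) + \<alpha> k"
      using r1 by (simp add: \<gamma>_def)
    have "Z (Suc k) = Z k + \<alpha> k *\<^sub>R p k + a k *\<^sub>R p k"
      using Z_shift[of k] Y[of k] Suc.prems by (simp add: Z_def)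
    also have "\<dots> = Z k + \<alpha> (Suc k) *\<^sub>R p k"
      by (simp add: a_def algebra_simps)
    also have "\<dots> = (1 + r) *\<^sub>R R k + (\<alpha> k + r * \<alpha> (Suc k)) *\<^sub>R g k + \<alpha> (Suc k) *\<^sub>R g (Suc k)"
      using Suc by (simp add: p_def algebra_simps)
    also have "\<dots> = (1 + r) *\<^sub>R R (Suc k) + \<alpha> (Suc k) *\<^sub>R g (Suc k)"
      using \<gamma> by (simp add: R_def scaleR_add_right add.commute)
    finally show ?case .
  qed (simp add: Z_def R_def \<alpha>0)
  have V_shift: "(\<Sum>s<k. \<gamma> s * (inner (g s) (y s - y (Suc k)) - \<phi> s)) = V k + inner (R k) (p k)"
    if "k < n" for k
  proof -
    have "y s - y (Suc k) = (y s - y k) + p k" for s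
      using Y[OF that] by (simp add: algebra_simps)
    hence "(\<Sum>s<k. \<gamma> s * (inner (g s) (y s - y (Suc k)) - \<phi> s))
        = (\<Sum>s<k. \<gamma> s * (inner (g s) (y s - y k) - \<phi> s) + inner (\<gamma> s *\<^sub>R g s) (p k))"
      by (simp only: inner_add_right inner_scaleR_left) (simp add: algebra_simps)
    thus ?thesis
      by (simp add: V_def R_def sum.distrib inner_sum_left)
  qed
  have V_Suc: "V (Suc k) = V k + inner (R k) (p k) + \<gamma> k * (inner (g k) (p k) - \<phi> k)"
    if "k < n" for k
    using V_shift[OF that] Y[OF that] by (simp add: V_def)
  have forward: "0 \<le> \<phi> k - \<phi> (Suc k) - inner (g (Suc k)) (p k)"
    and backward: "0 \<le> \<phi> (Suc k) - \<phi> k + inner (g k) (p k)" if "k < n" for k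
  proof -
    have "y (Suc k) - y k = - p k"
      using Y[OF that] by (metis minus_diff_eq)
    thus "0 \<le> \<phi> k - \<phi> (Suc k) - inner (g (Suc k)) (p k)"
      "0 \<le> \<phi> (Suc k) - \<phi> k + inner (g k) (p k)"
      using subgrad[of k "Suc k"] subgrad[of "Suc k" k] Y[OF that] that by auto
  qed
  have fan: "0 \<le> \<Phi> k - \<alpha> k * \<phi> (Suc k) - inner (g (Suc k)) (Z k + \<alpha> k *\<^sub>R p k)"
    if "k < n" for k
  proof -
    have "0 \<le> (\<Sum>i<k. a i * (\<phi> i - \<phi> (Suc k) - inner (g (Suc k)) (y i - y (Suc k))))"
      using that subgrad a_nonneg by (intro sum_nonneg mult_nonneg_nonneg) auto
    also have "\<dots> = \<Phi> k - \<alpha> k * \<phi> (Suc k)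
        - inner (g (Suc k)) (\<Sum>i<k. a i *\<^sub>R (y i - y (Suc k)))"
      by (simp add: \<Phi>_def inner_sum_right right_diff_distrib sum_subtractf sum_distrib_right
          flip: sum_a)
    finally show ?thesis using Z_shift[OF that] by simp
  qed
  \<comment> \<open>The sum of all inequalities with weights \<open>D\<close>, \<open>\<beta>\<close> and \<open>a\<close> among the indices up to \<open>k\<close>; the factor of
    \<open>\<Phi> k\<close> counts the weight still to be spent on targets beyond \<open>k\<close>.\<close>
  have invariant: "V k + r * inner (R k) (g k)
      \<le> H k - (real n - 1 - real k + 1 / (1 + r)) * \<Phi> k - ((1 - r) * D k + r * \<alpha> k) * \<phi> k
        - D k * inner (g k) (g k)" if "k < n" for k
    using that
  proof (induction k)
    case 0
    show ?case by (simp add: V_def R_def H_def \<Phi>_def D_def \<alpha>0)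
  next
    case (Suc k)
    let ?N = "real n - 2 - real k + 1 / (1 + r)"
    have k: "k < n" using Suc.prems by simp
    have "D (Suc k) - \<alpha> k \<ge> 0"
      using D_ge[OF Suc.prems] \<alpha>_mono[OF Suc.prems] by linarith
    hence F: "0 \<le> (D (Suc k) - \<alpha> k) * (\<phi> k - \<phi> (Suc k) - inner (g (Suc k)) (p k))"
      using forward[OF k] by simp
    have "\<beta> k \<ge> 0"
      using D_ge[OF Suc.prems] r by (simp add: \<beta>_def)
    hence B: "0 \<le> \<beta> k * (\<phi> (Suc k) - \<phi> k + inner (g k) (p k))"
      using backward[OF k] by simp
    \<comment> \<open>In the identity that closes this induction step, \<open>cross\<close>
      (rewritten as \<open>cross'\<close>), \<open>diag\<close> and \<open>bal\<close> match the
      coefficients of \<open>inner (g k) (g (Suc k))\<close>, \<open>inner (g k) (g k)\<close> and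
      \<open>\<phi> k\<close>. The recurrence for \<open>\<alpha>\<close> enters through
      \<open>bal\<close>.\<close>
    have cross: "(1 + r) * \<gamma> k = r * \<alpha> (Suc k) + \<alpha> k"
      using r1 by (simp add: \<gamma>_def)
    have "\<rho> * r\<^sup>2 = 1" using r by (simp add: \<rho>_def)
    hence \<rho>k: "r\<^sup>2 * \<rho> ^ Suc k = \<rho> ^ k" by (simp add: algebra_simps)
    define P where "P = \<rho> ^ Suc k"
    have D1: "2 * (1 + r) * D (Suc k) = P - 1 + 2 * r * \<alpha> (Suc k)"
      and D0: "2 * (1 + r) * D k = r\<^sup>2 * P - 1 + 2 * r * \<alpha> k"
      unfolding P_def \<rho>k D_mult by simp_all
    have "2 * ((1 - r) / 2) = 1 - r" by simp
    hence "(2 * (1 + r)) * (r * \<gamma> k + r * \<beta> k) = (2 * (1 + r)) * ((1 - r) / 2 + D k)"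
      using D0 D1 cross unfolding \<beta>_def by algebra
    hence diag: "r * \<gamma> k + r * \<beta> k = (1 - r) / 2 + D k"
      using r1 by simp
    have N: "(1 + r) * ?N = (1 + r) * (real n - 2 - real k) + 1"
      using r1 by (simp add: distrib_left)
    have rec: "2 * (real n - 1 - real k) * (\<alpha> (Suc k) - \<alpha> k)
        = 4 * \<alpha> k + 2 - (1 - r)\<^sup>2 * P"
      using \<alpha>_rec[OF Suc.prems] unfolding P_def by (simp add: algebra_simps)
    have "(2 * (1 + r)) * (1 - ?N * a k + ((1 - r) * D k + r * \<alpha> k))
        = (2 * (1 + r)) * (- \<gamma> k + D (Suc k) - \<alpha> k - \<beta> k)"
      using D0 D1 cross N rec unfolding \<beta>_def a_def by algebra
    hence bal: "1 - ?N * a k + ((1 - r) * D k + r * \<alpha> k) = - \<gamma> k + D (Suc k) - \<alpha> k - \<beta> k"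
      using r1 by simp
    let ?G = "inner (g k) (g k)" and ?G' = "inner (g k) (g (Suc k))"
      and ?G'' = "inner (g (Suc k)) (g (Suc k))"
      and ?S = "inner (R k) (g k)" and ?S' = "inner (R k) (g (Suc k))"
    have J: "0 \<le> \<Phi> k - \<alpha> k * \<phi> (Suc k)
        - ((1 + r) * ?S' + \<alpha> k * ?G' + \<alpha> k * (?G'' + r * ?G'))"
      using fan[OF k] unfolding Z_eq[OF less_imp_le[OF k]] p_def
      by (simp add: inner_add_right inner_commute)
    have F': "0 \<le> (D (Suc k) - \<alpha> k) * (\<phi> k - \<phi> (Suc k) - (?G'' + r * ?G'))"
      using F unfolding p_def by (simp add: inner_add_right inner_commute)
    have B': "0 \<le> \<beta> k * (\<phi> (Suc k) - \<phi> k + (?G' + r * ?G))"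
      using B unfolding p_def by (simp add: inner_add_right)
    have V': "V (Suc k) = V k + (?S' + r * ?S) + \<gamma> k * (?G' + r * ?G - \<phi> k)"
      using V_Suc[OF k] unfolding p_def by (simp add: inner_add_right)
    have R': "inner (R (Suc k)) (g (Suc k)) = ?S' + \<gamma> k * ?G'"
      by (simp add: R_def inner_add_left)
    have H': "H (Suc k) = H k + \<phi> k + (1 - r) / 2 * ?G"
      by (simp add: H_def)
    have \<Phi>': "\<Phi> (Suc k) = \<Phi> k + a k * \<phi> k"
      by (simp add: \<Phi>_def)
    have N': "real n - 1 - real (Suc k) + 1 / (1 + r) = ?N"
      "real n - 1 - real k + 1 / (1 + r) = ?N + 1" by simp_all
    define c where "c k = (1 - r) * D k + r * \<alpha> k" for k
    define N where "N = ?N"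
    have c: "c (Suc k) = D (Suc k) - \<beta> k"
      by (simp add: c_def \<beta>_def algebra_simps)
    have cross': "\<gamma> k + r * \<gamma> k - \<alpha> k - r * D (Suc k) + \<beta> k = 0"
      using cross by (simp add: \<beta>_def algebra_simps)
    have bal': "1 - N * a k + c k = - \<gamma> k + D (Suc k) - \<alpha> k - \<beta> k"
      using bal by (simp add: c_def N_def)
    have "(H (Suc k) - N * \<Phi> (Suc k) - c (Suc k) * \<phi> (Suc k) - D (Suc k) * ?G'')
          - (V (Suc k) + r * inner (R (Suc k)) (g (Suc k)))
        = ((H k - (N + 1) * \<Phi> k - c k * \<phi> k - D k * ?G) - (V k + r * ?S))
          + (\<Phi> k - \<alpha> k * \<phi> (Suc k) - ((1 + r) * ?S' + \<alpha> k * ?G' + \<alpha> k * (?G'' + r * ?G')))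
          + (D (Suc k) - \<alpha> k) * (\<phi> k - \<phi> (Suc k) - (?G'' + r * ?G'))
          + \<beta> k * (\<phi> (Suc k) - \<phi> k + (?G' + r * ?G))"
      using cross' bal' diag unfolding V' R' H' \<Phi>' c by algebra
    moreover have "V k + r * ?S \<le> H k - (N + 1) * \<Phi> k - c k * \<phi> k - D k * ?G"
      using Suc.IH[OF k] unfolding N' c_def N_def .
    ultimately show ?case
      using J F' B' unfolding N' c_def[symmetric] N_def[symmetric] by linarith
  qed
  obtain m where m: "n = Suc m" using n by (cases n) auto
  have mn: "m < n" using m by simp
  define M where "M = 1 / r ^ n"
  have M: "M = 1 + real n * (1 + r)"
    using root r by (simp add: M_def field_simps)
  have "\<rho> * r\<^sup>2 = 1" using r by (simp add: \<rho>_def)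
  hence \<rho>m: "\<rho> ^ m = r\<^sup>2 * \<rho> ^ n" by (simp add: m algebra_simps)
  have \<rho>n: "\<rho> ^ n = M\<^sup>2"
    by (simp add: \<rho>_def M_def power_divide flip: power_mult) (simp add: mult.commute)
  let ?G = "inner (g m) (g m)" and ?G' = "inner (g m) (g n)" and ?G'' = "inner (g n) (g n)"
    and ?S = "inner (R m) (g m)" and ?S' = "inner (R m) (g n)"
  \<comment> \<open>\<open>L\<close> is the claimed coefficient of \<open>?G''\<close>. The pairs
    \<open>(i,n)\<close> with \<open>i < m\<close> supply \<open>q\<close> of it, so
    \<open>(m,n)\<close> must supply \<open>L - q\<close>; the weight \<open>r * L + q\<close> of
    \<open>(n,m)\<close> then cancels \<open>?G'\<close>.\<close>
  define L where "L = real n * (1 + M) / 2"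
  define q where "q = \<alpha> m / (1 + r)"
  have q: "(1 + r) * q = \<alpha> m" using r1 by (simp add: q_def)
  have last: "4 * \<alpha> m = (1 - r)\<^sup>2 * M\<^sup>2 - 2"
    using \<alpha>_last by (simp add: m flip: \<rho>n)
  have Dm: "2 * (1 + r) * D m = r\<^sup>2 * M\<^sup>2 - 1 + 2 * r * \<alpha> m"
    unfolding D_mult \<rho>m \<rho>n by simp
  have M1: "M \<ge> 1" unfolding M using r by simp
  have L: "2 * (1 + r) * L = M\<^sup>2 - 1"
    unfolding L_def M by (simp add: power2_eq_square algebra_simps)
  have "L \<ge> 0" unfolding L_def using M1 by simp
  have "\<alpha> m \<ge> 0" using \<alpha>_nonneg mn by simp
  hence "q \<ge> 0" unfolding q_def using r1 by simp
  have "2 * \<alpha> m \<le> M\<^sup>2 - 1"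
  proof -
    have "2 * \<alpha> m \<le> r\<^sup>2 * M\<^sup>2 - 1"
      using \<alpha>_le[OF mn] unfolding \<rho>m \<rho>n by simp
    also have "\<dots> \<le> 1 * M\<^sup>2 - 1"
      using r by (intro diff_right_mono mult_right_mono) (auto simp: power_le_one)
    finally show ?thesis by simp
  qed
  hence "2 * ((1 + r) * q) \<le> 2 * ((1 + r) * L)"
    unfolding q using L by (simp only: mult.assoc)
  hence "q \<le> L" using r1 by simp
  have F: "0 \<le> (L - q) * (\<phi> m - (?G'' + r * ?G'))"
    using forward[OF mn] \<open>q \<le> L\<close> \<phi>n unfolding p_def m[symmetric]
    by (simp add: inner_add_right inner_commute)
  have B: "0 \<le> (r * L + q) * (- \<phi> m + (?G' + r * ?G))"
    using backward[OF mn] \<open>q \<ge> 0\<close> \<open>L \<ge> 0\<close> r \<phi>n unfolding p_def m[symmetric]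
    by (simp add: inner_add_right)
  have "0 \<le> \<Phi> m - ((1 + r) * ?S' + \<alpha> m * ?G' + \<alpha> m * (?G'' + r * ?G'))"
    using fan[OF mn] \<phi>n unfolding Z_eq[OF less_imp_le[OF mn]] p_def m[symmetric]
    by (simp add: inner_add_right inner_commute)
  \<comment> \<open>For the last target only \<open>?S'\<close> has to be cancelled, against
    \<open>(1 + r) * ?S'\<close> for the earlier ones; hence the factor
    \<open>1 / (1 + r)\<close>.\<close>
  hence J: "0 \<le> 1 / (1 + r) * (\<Phi> m - ((1 + r) * ?S' + \<alpha> m * ?G' + \<alpha> m * (?G'' + r * ?G')))"
    using r1 by simp
  have "0 \<le> (\<Sum>s<m. \<gamma> s * (inner (g s) (y s - y n) - \<phi> s))"
  proof (intro sum_nonneg mult_nonneg_nonneg)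
    fix s assume s: "s \<in> {..<m}"
    thus "0 \<le> \<gamma> s" using \<gamma>_nonneg m by simp
    have "inner (g s) (y s - y n) = - inner (g s) (y n - y s)"
      by (simp add: inner_diff_right)
    thus "0 \<le> inner (g s) (y s - y n) - \<phi> s"
      using subgrad[of n s] s m \<phi>n by simp
  qed
  hence V: "0 \<le> V m + (?S' + r * ?S)"
    using V_shift[OF mn] unfolding p_def m[symmetric] by (simp add: inner_add_right)
  define u where "u = 1 / (1 + r)"
  have u: "(1 + r) * u = 1" using r1 by (simp add: u_def)
  have I: "V m + r * ?S \<le> H m - u * \<Phi> m - ((1 - r) * D m + r * \<alpha> m) * \<phi> m - D m * ?G"
    using invariant[OF mn] by (simp add: m u_def)
  have "2 * ((1 - r) / 2) = 1 - r" by simp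
  hence "2 * (1 + r) * (r * (r * L + q)) = 2 * (1 + r) * ((1 - r) / 2 + D m)"
    using Dm L q by algebra
  hence diag: "r * (r * L + q) = (1 - r) / 2 + D m"
    using r1 by simp
  have "2 * (1 + r) * (1 + ((1 - r) * D m + r * \<alpha> m)) = 2 * (1 + r) * ((L - q) - (r * L + q))"
    using Dm L q last by algebra
  hence bal: "1 + ((1 - r) * D m + r * \<alpha> m) = (L - q) - (r * L + q)"
    using r1 by simp
  have "H n - L * ?G'' = ((H m - u * \<Phi> m - ((1 - r) * D m + r * \<alpha> m) * \<phi> m - D m * ?G) - (V m + r * ?S))
      + (V m + (?S' + r * ?S))
      + u * (\<Phi> m - ((1 + r) * ?S' + \<alpha> m * ?G' + \<alpha> m * (?G'' + r * ?G')))
      + (L - q) * (\<phi> m - (?G'' + r * ?G')) + (r * L + q) * (- \<phi> m + (?G' + r * ?G))"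
  proof -
    have "H n = H m + \<phi> m + (1 - r) / 2 * ?G"
      by (simp add: H_def m)
    thus ?thesis using u q diag bal by algebra
  qed
  hence "L * ?G'' \<le> H n"
    using I V J F B unfolding u_def[symmetric] by linarith
  thus ?thesis unfolding L_def M_def H_def .
qed

section \<open>Gradients and interpolation for smooth convex functions\<close>

lemma has_real_derivative_along_line:
  fixes f :: "'a::real_inner \<Rightarrow> real"
  assumes "\<And>x. GDERIV f x :> G x"
  shows "((\<lambda>t. f (x + t *\<^sub>R d)) has_real_derivative inner d (G (x + t *\<^sub>R d))) (at t)"
proof -
  have "((\<lambda>t. x + t *\<^sub>R d) has_derivative (\<lambda>h. h *\<^sub>R d)) (at t)"
    by (auto intro!: derivative_eq_intros)
  hence "((\<lambda>t. f (x + t *\<^sub>R d)) has_derivative (\<lambda>h. inner (h *\<^sub>R d) (G (x + t *\<^sub>R d)))) (at t)"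
    using assms unfolding gderiv_def by (rule has_derivative_compose)
  thus ?thesis
    by (simp add: has_field_derivative_def mult.commute[of _ "inner d _"] fun_eq_iff)
qed

lemma convex_gradient_inequality:
  fixes f :: "'a::real_inner \<Rightarrow> real"
  assumes der: "\<And>x. GDERIV f x :> G x" and conv: "convex_on UNIV f"
  shows "f x + inner (G x) (y - x) \<le> f y"
proof -
  let ?u = "\<lambda>t. f (x + t *\<^sub>R (y - x))"
  have "convex_on UNIV ?u"
  proof (rule convex_onI)
    fix t a b :: real
    assume t: "0 < t" "t < 1"
    have "x + ((1 - t) *\<^sub>R a + t *\<^sub>R b) *\<^sub>R (y - x)
        = (1 - t) *\<^sub>R (x + a *\<^sub>R (y - x)) + t *\<^sub>R (x + b *\<^sub>R (y - x))"
      by (simp add: algebra_simps)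
    thus "?u ((1 - t) *\<^sub>R a + t *\<^sub>R b) \<le> (1 - t) * ?u a + t * ?u b"
      using convex_onD[OF conv, of t] t by simp
  qed simp
  moreover have "(?u has_real_derivative inner (y - x) (G (x + 0 *\<^sub>R (y - x)))) (at 0)"
    by (rule has_real_derivative_along_line[OF der])
  ultimately have "?u 1 - ?u 0 \<ge> inner (y - x) (G (x + 0 *\<^sub>R (y - x))) * (1 - 0)"
    by (intro convex_on_imp_above_tangent[where A = UNIV]) auto
  thus ?thesis by (simp add: inner_commute)
qed

lemma smooth_descent:
  fixes f :: "'a::real_inner \<Rightarrow> real"
  assumes der: "\<And>x. GDERIV f x :> G x" and lip: "\<And>x y. norm (G x - G y) \<le> norm (x - y)"
  shows "f y \<le> f x + inner (G x) (y - x) + (norm (y - x))\<^sup>2 / 2"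
proof -
  define d where "d = y - x"
  \<comment> \<open>Removing the linear and quadratic terms of the bound leaves a derivative that
    Cauchy-Schwarz and the Lipschitz condition make nonpositive.\<close>
  define u where "u t = f (x + t *\<^sub>R d) - t * inner d (G x) - t\<^sup>2 / 2 * (norm d)\<^sup>2" for t
  have "u 1 \<le> u 0"
  proof (rule DERIV_nonpos_imp_nonincreasing[of 0 1 u])
    fix t :: real assume t: "0 \<le> t" "t \<le> 1"
    let ?D = "inner d (G (x + t *\<^sub>R d)) - inner d (G x) - t * (norm d)\<^sup>2"
    have "(u has_real_derivative ?D) (at t)"
      unfolding u_def by (auto intro!: derivative_eq_intros has_real_derivative_along_line[OF der])
    moreover have "?D \<le> 0"
    proof -
      have "inner d (G (x + t *\<^sub>R d) - G x) \<le> norm d * norm (G (x + t *\<^sub>R d) - G x)"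
        by (rule norm_cauchy_schwarz)
      also have "\<dots> \<le> norm d * norm ((x + t *\<^sub>R d) - x)"
        by (intro mult_left_mono lip) auto
      also have "\<dots> = t * (norm d)\<^sup>2"
        using t by (simp add: power2_eq_square)
      finally show ?thesis by (simp add: inner_diff_right)
    qed
    ultimately show "\<exists>D. (u has_real_derivative D) (at t) \<and> D \<le> 0" by blast
  qed simp
  thus ?thesis by (simp add: u_def d_def inner_commute)
qed

text \<open>The tangent at \<open>x\<close> and the quadratic upper bound at \<open>y\<close> are
  compared at \<open>y - (G y - G x)\<close>, the point where the gap between them is
  smallest.\<close>

lemma smooth_convex_interpolation:
  fixes f :: "'a::real_inner \<Rightarrow> real"
  assumes der: "\<And>x. GDERIV f x :> G x" and lip: "\<And>x y. norm (G x - G y) \<le> norm (x - y)"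
    and conv: "convex_on UNIV f"
  shows "f x + inner (G x) (y - x) + (norm (G y - G x))\<^sup>2 / 2 \<le> f y"
proof -
  define d where "d = G y - G x"
  have "f x + inner (G x) ((y - d) - x) \<le> f (y - d)"
    by (rule convex_gradient_inequality[OF der conv])
  also have "\<dots> \<le> f y + inner (G y) ((y - d) - y) + (norm ((y - d) - y))\<^sup>2 / 2"
    by (rule smooth_descent[OF der lip])
  finally have "f x + inner (G x) (y - x) + inner (G y - G x) d - (norm d)\<^sup>2 / 2 \<le> f y"
    by (simp add: inner_diff_left inner_diff_right)
  thus ?thesis unfolding d_def power2_norm_eq_inner by simp
qed

text \<open>Riesz representation in the standard basis gives existence, nondegeneracy of the inner
  product uniqueness; so the definite description in \<open>grad\<close> denotes.\<close>

lemma GDERIV_grad: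
  fixes f :: "'a::euclidean_space \<Rightarrow> real"
  assumes "f differentiable at x"
  shows "GDERIV f x :> grad f x"
proof -
  obtain f' where f': "(f has_derivative f') (at x)"
    using assms by (auto simp: differentiable_def)
  interpret linear f' using f' by (rule has_derivative_linear)
  have "f' = (\<lambda>h. inner h (\<Sum>b\<in>Basis. f' b *\<^sub>R b))"
  proof
    fix h
    have "f' h = f' (\<Sum>b\<in>Basis. inner h b *\<^sub>R b)" by (simp add: euclidean_representation)
    also have "\<dots> = inner h (\<Sum>b\<in>Basis. f' b *\<^sub>R b)"
      by (simp add: sum scale inner_sum_right mult.commute)
    finally show "f' h = inner h (\<Sum>b\<in>Basis. f' b *\<^sub>R b)" .
  qed
  hence ex: "GDERIV f x :> (\<Sum>b\<in>Basis. f' b *\<^sub>R b)"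
    using f' by (simp add: gderiv_def)
  have uniq: "g = g'" if "GDERIV f x :> g" "GDERIV f x :> g'" for g g'
  proof -
    have "(\<lambda>h. inner h g) = (\<lambda>h. inner h g')"
      using that unfolding gderiv_def by (rule has_derivative_unique)
    hence "\<forall>h. inner h g = inner h g'" by metis
    thus ?thesis by (metis vector_eq_ldot)
  qed
  show ?thesis
    unfolding grad_def by (rule theI[where P = "\<lambda>g. GDERIV f x :> g"]) (use ex uniq in auto)
qed

section \<open>Gradient descent with a constant step\<close>

lemma constant_step_average_decrease:
  fixes f :: "'a::real_inner \<Rightarrow> real"
  assumes der: "\<And>x. GDERIV f x :> G x" and lip: "\<And>x y. norm (G x - G y) \<le> norm (x - y)"
    and conv: "convex_on UNIV f"
    and r: "0 < r" "r < 1" and n: "n \<ge> 1" and root: "r ^ n * (1 + real n * (1 + r)) = 1"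
    and step: "\<And>k. k < n \<Longrightarrow> x (Suc k) = x k - (1 + r) *\<^sub>R G (x k)"
  shows "real n / r ^ n * (norm (G (x n)))\<^sup>2 + r * (\<Sum>j<n. (norm (G (x j)))\<^sup>2)
    \<le> 2 * ((\<Sum>j<n. f (x j)) - real n * f (x n))"
proof -
  define g where "g k = G (x k)" for k
  define c where "c = 1 / r ^ n"
  define y where "y k = x k - g k" for k
  define \<psi> where "\<psi> k = f (x k) - inner (g k) (g k) / 2" for k
  have "inner (g j) (y i - y j) \<le> (\<psi> i - \<psi> n) - (\<psi> j - \<psi> n)" for i j
    using smooth_convex_interpolation[OF der lip conv, of "x j" "x i"]
    by (simp add: y_def \<psi>_def g_def power2_norm_eq_inner inner_diff_left inner_diff_right
        inner_add_right inner_commute[of "G (x i)" "G (x j)"] field_simps)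
  moreover have "y k - y (Suc k) = g (Suc k) + r *\<^sub>R g k" if "k < n" for k
    using step[OF that] by (simp add: y_def g_def algebra_simps)
  ultimately have "real n * (1 + 1 / r ^ n) / 2 * inner (g n) (g n)
      \<le> (\<Sum>j<n. (\<psi> j - \<psi> n) + (1 - r) / 2 * inner (g j) (g j))"
    by (intro weighted_gap[OF r n root]) auto
  also have "\<dots> = (\<Sum>j<n. (f (x j) - r / 2 * inner (g j) (g j)) - \<psi> n)"
    by (intro sum.cong) (auto simp: \<psi>_def field_simps)
  also have "\<dots> = (\<Sum>j<n. f (x j)) - r / 2 * (\<Sum>j<n. inner (g j) (g j)) - real n * \<psi> n"
    by (simp add: sum_subtractf sum_distrib_left)
  finally have "real n * (1 + c) / 2 * inner (g n) (g n) \<le> (\<Sum>j<n. f (x j))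
      - r / 2 * (\<Sum>j<n. inner (g j) (g j)) - real n * \<psi> n"
    unfolding c_def .
  \<comment> \<open>The term \<open>real n * \<psi> n\<close> contains half of \<open>n\<close>
    squared norms of \<open>g n\<close>, which turns \<open>1 + c\<close> into
    \<open>c\<close>.\<close>
  hence "real n * c * inner (g n) (g n) + r * (\<Sum>j<n. inner (g j) (g j))
      \<le> 2 * ((\<Sum>j<n. f (x j)) - real n * f (x n))"
    unfolding \<psi>_def by (simp add: field_simps)
  thus ?thesis
    by (simp add: c_def g_def power2_norm_eq_inner)
qed

text \<open>Each step of the distance expansion leaves an excess
  \<open>(1 + r)\<^sup>2 - (1 + r) = r * (1 + r)\<close> of the squared gradient norm. The preceding
  lemma pays for the sum of these while trading the values at earlier iterates for
  \<open>f (x n)\<close>.\<close>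

lemma constant_step_bound:
  fixes f :: "'a::real_inner \<Rightarrow> real"
  assumes der: "\<And>x. GDERIV f x :> G x" and lip: "\<And>x y. norm (G x - G y) \<le> norm (x - y)"
    and conv: "convex_on UNIV f" and crit: "G xs = 0"
    and r: "0 < r" "r < 1" and n: "n \<ge> 1" and root: "r ^ n * (1 + real n * (1 + r)) = 1"
    and step: "\<And>k. k < n \<Longrightarrow> x (Suc k) = x k - (1 + r) *\<^sub>R G (x k)"
  shows "(norm (x n - xs))\<^sup>2 + 2 * (1 + r) * real n * (f (x n) - f xs)
      + (1 + r) * real n / r ^ n * (norm (G (x n)))\<^sup>2 \<le> (norm (x 0 - xs))\<^sup>2"
proof -
  have dist: "(norm (x k - xs))\<^sup>2 \<le> (norm (x 0 - xs))\<^sup>2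
      - (1 + r) * (2 * (\<Sum>j<k. f (x j) - f xs) - r * (\<Sum>j<k. (norm (G (x j)))\<^sup>2))"
    if "k \<le> n" for k
    using that
  proof (induction k)
    case (Suc k)
    have "f (x k) - f xs \<le> inner (G (x k)) (x k - xs) - (norm (G (x k)))\<^sup>2 / 2"
      using smooth_convex_interpolation[OF der lip conv, of "x k" xs] crit
      by (simp add: inner_diff_right)
    hence "(1 + r) * (2 * (f (x k) - f xs))
        \<le> (1 + r) * (2 * inner (G (x k)) (x k - xs) - (norm (G (x k)))\<^sup>2)"
      using r by (intro mult_left_mono) auto
    moreover have "x (Suc k) - xs = (x k - xs) - (1 + r) *\<^sub>R G (x k)"
      using step[of k] Suc.prems by simp
    hence "(norm (x (Suc k) - xs))\<^sup>2 = (norm (x k - xs))\<^sup>2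
        - 2 * (1 + r) * inner (G (x k)) (x k - xs) + (1 + r)\<^sup>2 * (norm (G (x k)))\<^sup>2"
      by (simp only: power2_norm_eq_inner)
        (simp add: inner_diff_left inner_diff_right inner_commute power2_eq_square algebra_simps)
    ultimately show ?case
      using Suc by (simp add: algebra_simps power2_eq_square)
  qed simp
  have "(1 + r) * (real n / r ^ n * (norm (G (x n)))\<^sup>2 + r * (\<Sum>j<n. (norm (G (x j)))\<^sup>2))
      \<le> (1 + r) * (2 * ((\<Sum>j<n. f (x j)) - real n * f (x n)))"
    using constant_step_average_decrease[where x = x, OF der lip conv r n root step] r
    by (intro mult_left_mono) auto
  with dist[of n] show ?thesis
    by (simp add: sum_subtractf algebra_simps)
qed

section \<open>The root equation and composability\<close>

lemma root_exists_unique: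
  assumes "n \<ge> 1"
  shows "\<exists>!r::real. 0 < r \<and> r < 1 \<and> r ^ n * (1 + real n * (1 + r)) = 1"
proof -
  let ?p = "\<lambda>r::real. r ^ n * (1 + real n * (1 + r))"
  have less: "?p s < ?p t" if "0 < s" "s < t" for s t
    using that assms by (intro mult_strict_mono power_strict_mono) auto
  have "\<exists>r\<ge>0. r \<le> 1 \<and> ?p r = 1"
    using assms by (intro IVT') (auto intro!: continuous_intros simp: power_0_left)
  then obtain r where "0 \<le> r" "r \<le> 1" "?p r = 1" by blast
  moreover from this assms have "r \<noteq> 0" "r \<noteq> 1" by (auto simp: power_0_left)
  ultimately have "0 < r \<and> r < 1 \<and> ?p r = 1" by simp
  moreover have "s = t" if "0 < s" "0 < t" "?p s = 1" "?p t = 1" for s t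
    using less[of s t] less[of t s] that by (cases s t rule: linorder_cases) auto
  ultimately show ?thesis by blast
qed

theorem theorem3p3:
  fixes n :: nat
  assumes "n \<ge> 1"
  shows "(\<exists>!r::real. 0 < r \<and> r < 1 \<and> r ^ n * (1 + real n * (1 + r)) = 1) \<and>
    (\<forall>r::real. 0 < r \<and> r < 1 \<and> r ^ n * (1 + real n * (1 + r)) = 1 \<longrightarrow>
       s_composable TYPE('n::finite) (replicate n (1 + r)) (r ^ n))"
proof (intro conjI allI impI root_exists_unique[OF assms])
  fix r :: real
  assume "0 < r \<and> r < 1 \<and> r ^ n * (1 + real n * (1 + r)) = 1"
  hence r: "0 < r" "r < 1" and root: "r ^ n * (1 + real n * (1 + r)) = 1" by auto
  let ?hs = "replicate n (1 + r)"
  define \<eta> where "\<eta> = r ^ n"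
  have \<eta>: "\<eta> > 0" using r by (simp add: \<eta>_def)
  have \<eta>_root: "\<eta> * ((1 + r) * real n) = 1 - \<eta>"
    using root by (simp add: \<eta>_def algebra_simps)
  have "s_composable_bound TYPE('n) ?hs \<eta>"
    unfolding s_composable_bound_def Let_def length_replicate
  proof (intro allI impI)
    fix f :: "real ^ 'n \<Rightarrow> real" and xs x0 :: "real ^ 'n"
    assume smooth: "one_smooth f" and conv: "convex_on UNIV f" and min: "\<forall>y. f xs \<le> f y"
    have der: "GDERIV f x :> grad f x" for x
      using smooth by (intro GDERIV_grad) (auto simp: one_smooth_def differentiable_on_def)
    have lip: "norm (grad f x - grad f y) \<le> norm (x - y)" for x y
      using smooth lipschitz_onD[of 1 UNIV "grad f" x y] by (auto simp: one_smooth_def dist_norm)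
    have "(\<lambda>h. inner h (grad f xs)) = (\<lambda>h. 0)"
      using der[of xs] min unfolding gderiv_def
      by (intro differential_zero_maxmin[of xs UNIV f]) auto
    hence crit: "grad f xs = 0" by (metis inner_eq_zero_iff)
    define x where "x = gd_iterate f ?hs x0"
    have "x (Suc k) = x k - (1 + r) *\<^sub>R grad f (x k)" if "k < n" for k
      using that by (simp add: x_def)
    hence "(norm (x n - xs))\<^sup>2 + 2 * (1 + r) * real n * (f (x n) - f xs)
        + (1 + r) * real n / \<eta> * (norm (grad f (x n)))\<^sup>2 \<le> (norm (x 0 - xs))\<^sup>2"
      unfolding \<eta>_def using constant_step_bound[where x = x, OF der lip conv crit r assms root] by blast
    \<comment> \<open>After this scaling, replacing \<open>\<eta> * ((1 + r) * real n)\<close> by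
      \<open>1 - \<eta>\<close> produces the coefficients \<open>(1 - \<eta>) / 2\<close> and
      \<open>\<eta> - \<eta>\<^sup>2\<close>.\<close>
    hence "\<eta>\<^sup>2 / 2 * ((norm (x n - xs))\<^sup>2 + 2 * (1 + r) * real n * (f (x n) - f xs)
        + (1 + r) * real n / \<eta> * (norm (grad f (x n)))\<^sup>2) \<le> \<eta>\<^sup>2 / 2 * (norm (x0 - xs))\<^sup>2"
      by (intro mult_left_mono) (auto simp: x_def)
    also have "\<eta>\<^sup>2 / 2 * ((norm (x n - xs))\<^sup>2 + 2 * (1 + r) * real n * (f (x n) - f xs)
        + (1 + r) * real n / \<eta> * (norm (grad f (x n)))\<^sup>2)
      = \<eta> * ((1 + r) * real n) / 2 * (norm (grad f (x n)))\<^sup>2 + \<eta>\<^sup>2 / 2 * (norm (x n - xs))\<^sup>2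
        + \<eta> * (\<eta> * ((1 + r) * real n)) * (f (x n) - f xs)"
      using \<eta> by (simp add: field_simps power2_eq_square)
    finally show "(1 - \<eta>) / 2 * (norm (grad f (gd_iterate f ?hs x0 n)))\<^sup>2
        + \<eta>\<^sup>2 / 2 * (norm (gd_iterate f ?hs x0 n - xs))\<^sup>2
        + (\<eta> - \<eta>\<^sup>2) * (f (gd_iterate f ?hs x0 n) - f xs) \<le> \<eta>\<^sup>2 / 2 * (norm (x0 - xs))\<^sup>2"
      unfolding \<eta>_root x_def by (simp add: right_diff_distrib power2_eq_square)
  qed
  moreover have "\<eta> = 1 / (1 + (\<Sum>i<length ?hs. ?hs ! i))"
  proof -
    have sum: "(\<Sum>i<length ?hs. ?hs ! i) = (1 + r) * real n" by simp
    have "\<eta> * (1 + (1 + r) * real n) = 1"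
      using \<eta>_root by (simp add: distrib_left)
    thus ?thesis
      unfolding sum using \<eta> by (intro nonzero_eq_divide_eq[THEN iffD2]) auto
  qed
  moreover have "\<eta> = (\<Prod>i<length ?hs. ?hs ! i - 1)"
    by (simp add: \<eta>_def)
  moreover have "\<forall>h\<in>set ?hs. h > 0"
    using r by simp
  ultimately show "s_composable TYPE('n) ?hs (r ^ n)"
    unfolding s_composable_def \<eta>_def[symmetric] by blast
qed

end
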